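(* Let $d \ge 2$ be an integer and let $\alpha \in (0,d)$. Let $r,s>1$ satisfy $\frac1r+\frac1s = 1+\frac{\alpha}{d}$. Then $$V_{\alpha,d}(r,s) \ \ge\ \frac{R(\alpha,d)}{[(r-1)(s-1)]^{1-\alpha/d}},$$ where $V_{\alpha,d}(r,s)$ is the best constant in the bilinear Riesz potential inequality and $R(\alpha,d)$ is the explicit constant, both defined in the context.
   Context: For $1\le p<\infty$, $L_p=L_p(\mathbb{R}^d)$ is the Lebesgue space of measurable $f:\mathbb{R}^d\to\mathbb{R}$ with finite norm $|f|_p=\left(\int_{\mathbb{R}^d}|f(x)|^p\,dx\right)^{1/p}$; for $x\in\mathbb{R}^d$, $|x|$ is the Euclidean norm. The bilinear Riesz functional is $$B_{\alpha,d}(f,g)=\int_{\mathbb{R}^d}\int_{\mathbb{R}^d}\frac{f(y)\,g(x)}{|x-y|^{d-\alpha}}\,dx\,dy,$$ and the best constant is $$V_{\alpha,d}(r,s)=\sup_{f\in L_r,\ f\ne0}\ \sup_{g\in L_s,\ g\neq 0}\frac{B_{\alpha,d}(f,g)}{|f|_r\,|g|_s}.$$ For each positive integer $k$, $\omega(k)=\frac{2\pi^{k/2}}{\Gamma(k/2)}$ (the surface area of the unit sphere in $\mathbb{R}^k$). Define $$a=a(\alpha,d)=e^{1/e}\cdot\max\left[\frac{\omega(d)}{\alpha},\left(\frac{\omega(d)}{\alpha}\right)^{d/\alpha}\right],\qquad m=m(\alpha,d)=\min\left(1,(\omega(d)/d)^{1-\alpha/d}\right),$$ $$A=A(\alpha,d)=\frac{4\pi}{9\alpha}\cdot\omega(d-1)\cdot2^{-d}\cdot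 m(\alpha,d),\qquad n=n(\alpha,d)=\max\left(\omega(d)/d,(\omega(d)/d)^{\alpha/d}\right),$$ $$D=D(\alpha,d)=3^{-1}\cdot4\cdot5^{\alpha-d}\cdot\omega(d)\cdot\min\left(1,(\omega(d))^{d/(d-\alpha)}\right)\cdot(d^2/\alpha)^{-2-\alpha/d}.$$ For $p\in[1,d/\alpha]$ put $$F_{\alpha,d}(p)=\frac12\cdot\frac{A\,(p-1)^{1/p+(d-\alpha)/d}+D\,(d/\alpha-p)^{1/p+(2d-\alpha)/d}}{a\,(p-1)^{1/p}+n\,(d/\alpha-p)^{\alpha/d}},$$ and $$R(\alpha,d)=\inf_{p\in[1,d/\alpha]}F_{\alpha,d}(p).$$ *)

theory Defs
  imports "HOL-Analysis.Analysis"
begin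

definition Lp_norm :: "real \<Rightarrow> (real ^ 'n \<Rightarrow> real) \<Rightarrow> real" where
  "Lp_norm p f = (LINT x|lebesgue. \<bar>f x\<bar> powr p) powr (1 / p)"

text \<open>Members of \<open>L\<^sub>p\<close> are functions rather than classes; the condition \<open>f \<noteq> 0\<close> in \<open>L\<^sub>p\<close>
  therefore reads ``not almost everywhere zero''.\<close>

definition Lp :: "real \<Rightarrow> (real ^ 'n \<Rightarrow> real) set" where
  "Lp p = {f \<in> borel_measurable lebesgue. integrable lebesgue (\<lambda>x. \<bar>f x\<bar> powr p)}"

definition Lp_nonzero :: "real \<Rightarrow> (real ^ 'n \<Rightarrow> real) set" where
  "Lp_nonzero p = {f \<in> Lp p. \<not> (AE x in lebesgue. f x = 0)}"

text \<open>On the null set \<open>x = y\<close> the kernel takes the value \<open>0\<close>, since \<open>0 powr t = 0\<close> and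
  \<open>u / 0 = 0\<close>.\<close>

definition riesz_B :: "real \<Rightarrow> (real ^ 'n \<Rightarrow> real) \<Rightarrow> (real ^ 'n \<Rightarrow> real) \<Rightarrow> real" where
  "riesz_B \<alpha> f g =
    (LINT y|lebesgue. (LINT x|lebesgue.
       f y * g x / norm (x - y) powr (real CARD('n) - \<alpha>)))"

text \<open>The supremum is taken in the extended reals, so that it needs no boundedness proof. The type
  argument carries the dimension \<open>d = CARD('n)\<close>.\<close>

definition riesz_V :: "'n::finite itself \<Rightarrow> real \<Rightarrow> real \<Rightarrow> real \<Rightarrow> ereal" where
  "riesz_V _ \<alpha> r s =
    (SUP f \<in> (Lp_nonzero r :: (real ^ 'n \<Rightarrow> real) set).
       SUP g \<in> (Lp_nonzero s :: (real ^ 'n \<Rightarrow> real) set).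
         ereal (riesz_B \<alpha> f g / (Lp_norm r f * Lp_norm s g)))"

definition omega :: "nat \<Rightarrow> real" where
  "omega k = 2 * pi powr (real k / 2) / Gamma (real k / 2)"

definition riesz_a :: "real \<Rightarrow> nat \<Rightarrow> real" where
  "riesz_a \<alpha> d =
    exp (1 / exp 1) * max (omega d / \<alpha>) ((omega d / \<alpha>) powr (real d / \<alpha>))"

definition riesz_m :: "real \<Rightarrow> nat \<Rightarrow> real" where
  "riesz_m \<alpha> d = min 1 ((omega d / real d) powr (1 - \<alpha> / real d))"

definition riesz_A :: "real \<Rightarrow> nat \<Rightarrow> real" where
  "riesz_A \<alpha> d =
    4 * pi / (9 * \<alpha>) * omega (d - 1) * 2 powr (- real d) * riesz_m \<alpha> d"

definition riesz_n :: "real \<Rightarrow> nat \<Rightarrow> real" where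
  "riesz_n \<alpha> d = max (omega d / real d) ((omega d / real d) powr (\<alpha> / real d))"

definition riesz_D :: "real \<Rightarrow> nat \<Rightarrow> real" where
  "riesz_D \<alpha> d =
    1 / 3 * 4 * 5 powr (\<alpha> - real d) * omega d
      * min 1 (omega d powr (real d / (real d - \<alpha>)))
      * ((real d)\<^sup>2 / \<alpha>) powr (- 2 - \<alpha> / real d)"

definition riesz_F :: "real \<Rightarrow> nat \<Rightarrow> real \<Rightarrow> real" where
  "riesz_F \<alpha> d p =
    1 / 2 *
    ((riesz_A \<alpha> d * (p - 1) powr (1 / p + (real d - \<alpha>) / real d)
      + riesz_D \<alpha> d * (real d / \<alpha> - p) powr (1 / p + (2 * real d - \<alpha>) / real d))
     / (riesz_a \<alpha> d * (p - 1) powr (1 / p)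
      + riesz_n \<alpha> d * (real d / \<alpha> - p) powr (\<alpha> / real d)))"

definition riesz_R :: "real \<Rightarrow> nat \<Rightarrow> real" where
  "riesz_R \<alpha> d = (INF p \<in> {1..real d / \<alpha>}. riesz_F \<alpha> d p)"

end

theory Submission
  imports Defs
begin

text \<open>Put \<open>\<kappa> = \<alpha> / d\<close>, \<open>x = 1 - 1 / r\<close>, \<open>y = 1 - 1 / s\<close>, \<open>z = x + y = 1 - \<kappa>\<close>, and let \<open>v\<close> be the
  volume of the unit ball. The functional is symmetric in its two arguments, so let \<open>x \<le> y\<close>.
  Indicators of the balls of radii \<open>1 / 2\<close> and \<open>1\<close> feel the singularity of the kernel and show
  that the best constant is at least \<open>v powr z / \<kappa> * (1/2) powr (d * (\<kappa> + x))\<close>; this is used if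
  \<open>\<kappa> < x\<close>. The indicator of the ball of radius \<open>1 / 2\<close>, tested against the power
  \<open>norm x powr (- (d - \<alpha>) / (s - 1))\<close> outside the unit ball, feels the tail of the kernel and
  supplies the factor \<open>(y / x) powr y\<close>, which blows up as \<open>r\<close> tends to \<open>1\<close>; this is used if
  \<open>x \<le> \<kappa>\<close>. In both cases the value at \<open>p = 1\<close> of the function whose infimum is \<open>R\<close> is already
  small enough.\<close>

section \<open>Integration of radial functions\<close>

text \<open>This is integration in polar coordinates. Half-lines are an intersection-stable
  generator of the Borel sets, and both measures give \<open>{..t}\<close> the volume of the closed
  ball of radius \<open>t\<close>, which is empty for \<open>t < 0\<close>.\<close>

lemma distr_norm_lborel:
  "distr lborel borel (norm :: 'a::euclidean_space \<Rightarrow> real) =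
     density lborel (\<lambda>t. ennreal (unit_ball_vol DIM('a) * DIM('a) * t ^ (DIM('a) - 1)) * indicator {0..} t)"
  (is "?M = ?N")
proof (rule measure_eqI_generator_eq[where E = "range atMost" and \<Omega> = UNIV and A = "\<lambda>n. {..real n}"])
  have M: "emeasure ?M {..t} = emeasure ?N {..t} \<and> emeasure ?M {..t} \<noteq> \<infinity>" for t :: real
  proof -
    have M: "emeasure ?M {..t} = emeasure lborel (cball 0 t :: 'a set)"
      by (subst emeasure_distr) (auto intro!: arg_cong[where f = "emeasure lborel"])
    have N: "emeasure ?N {..t} = (\<integral>\<^sup>+s. ennreal (unit_ball_vol DIM('a) * DIM('a) * s ^ (DIM('a) - 1)) * indicator {0..t} s \<partial>lborel)"
      by (subst emeasure_density) (auto intro!: nn_integral_cong split: split_indicator)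
    show ?thesis
    proof (cases "t \<ge> 0")
      case True
      have "((\<lambda>s. unit_ball_vol DIM('a) * DIM('a) * s ^ (DIM('a) - 1)) has_integral
          (unit_ball_vol DIM('a) * t ^ DIM('a) - unit_ball_vol DIM('a) * 0 ^ DIM('a))) {0..t}"
        by (rule fundamental_theorem_of_calculus[OF True])
           (auto simp flip: has_real_derivative_iff_has_vector_derivative intro!: derivative_eq_intros)
      then have "(\<integral>\<^sup>+s. ennreal (unit_ball_vol DIM('a) * DIM('a) * s ^ (DIM('a) - 1)) * indicator {0..t} s \<partial>lborel)
          = ennreal (unit_ball_vol DIM('a) * t ^ DIM('a) - unit_ball_vol DIM('a) * 0 ^ DIM('a))"
        by (intro nn_integral_has_integral_lebesgue') auto
      with True show ?thesis unfolding M N by (simp add: emeasure_cball)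
    next
      case False
      then have "{0..t} = {}" "cball 0 t = ({} :: 'a set)" by auto
      then show ?thesis unfolding M N by simp
    qed
  qed
  show "emeasure ?M X = emeasure ?N X" if "X \<in> range atMost" for X
    using that M by auto
  show "emeasure ?M {..real n} \<noteq> \<infinity>" for n using M by blast
  show "Int_stable (range atMost :: real set set)"
    by (auto simp: Int_stable_def)
  show "sets ?M = sigma_sets UNIV (range atMost)" "sets ?N = sigma_sets UNIV (range atMost)"
    by (simp_all add: borel_eq_atMost)
  show "(\<Union>n. {..real n}) = UNIV"
    by (auto simp: real_arch_simple)
qed auto

lemma nn_integral_radial:
  fixes h :: "real \<Rightarrow> ennreal"
  assumes [measurable]: "h \<in> borel_measurable borel"
  shows "(\<integral>\<^sup>+x. h (norm (x::'a::euclidean_space)) \<partial>lborel) =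
    (\<integral>\<^sup>+t. ennreal (unit_ball_vol DIM('a) * DIM('a) * t ^ (DIM('a) - 1)) * indicator {0..} t * h t \<partial>lborel)"
proof -
  have "(\<integral>\<^sup>+x. h (norm (x::'a)) \<partial>lborel) = (\<integral>\<^sup>+t. h t \<partial>distr lborel borel (norm :: 'a \<Rightarrow> real))"
    by (simp add: nn_integral_distr)
  then show ?thesis
    unfolding distr_norm_lborel by (simp add: nn_integral_density)
qed

text \<open>With \<open>a = \<alpha>\<close> this integrates the Riesz kernel around its
  singularity.\<close>

lemma nn_integral_norm_powr_ball:
  fixes \<rho> a :: real
  assumes "0 < \<rho>" "0 < a"
  shows "(\<integral>\<^sup>+x. ennreal (norm (x::'a::euclidean_space) powr (a - DIM('a))) * indicator (ball 0 \<rho>) x \<partial>lborel) =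
    ennreal (unit_ball_vol DIM('a) * DIM('a) / a * \<rho> powr a)"
proof -
  have "(\<integral>\<^sup>+x. ennreal (norm (x::'a) powr (a - DIM('a))) * indicator (ball 0 \<rho>) x \<partial>lborel)
     = (\<integral>\<^sup>+x. ennreal (norm (x::'a) powr (a - DIM('a))) * indicator {..<\<rho>} (norm x) \<partial>lborel)"
    by (auto intro!: nn_integral_cong split: split_indicator)
  also have "\<dots> = (\<integral>\<^sup>+t. ennreal (unit_ball_vol DIM('a) * DIM('a) * t ^ (DIM('a) - 1)) * indicator {0..} t
      * (ennreal (t powr (a - DIM('a))) * indicator {..<\<rho>} t) \<partial>lborel)"
    by (rule nn_integral_radial) measurable
  also have "\<dots> = (\<integral>\<^sup>+t. ennreal (unit_ball_vol DIM('a) * DIM('a) * t powr (a - 1)) * indicator {0..\<rho>} t \<partial>lborel)"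
  \<comment> \<open>The open ball gives a half-open range of radii, while the power is integrated
    over the closed one, so \<open>\<rho>\<close> is discarded as a null set. Discarding
    \<open>0\<close> too lets the powers be combined for \<open>t > 0\<close> only.\<close>
  proof (intro nn_integral_cong_AE)
    have "AE t in lborel. t \<noteq> 0 \<and> t \<noteq> \<rho>"
      by (intro AE_conjI AE_lborel_singleton)
    then show "AE t in lborel. ennreal (unit_ball_vol DIM('a) * DIM('a) * t ^ (DIM('a) - 1)) * indicator {0..} t
      * (ennreal (t powr (a - DIM('a))) * indicator {..<\<rho>} t)
      = ennreal (unit_ball_vol DIM('a) * DIM('a) * t powr (a - 1)) * indicator {0..\<rho>} t"
    proof eventually_elim
      case (elim t)
      have "t ^ (DIM('a) - 1) * t powr (a - DIM('a)) = t powr (a - 1)" if "t > 0"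
        using that by (simp flip: powr_realpow powr_add add: of_nat_diff Suc_leI)
      with elim show ?case
        by (auto simp: mult.assoc simp flip: ennreal_mult split: split_indicator)
    qed
  qed
  also have "\<dots> = ennreal (unit_ball_vol DIM('a) * DIM('a) * (\<rho> powr (a - 1 + 1) / (a - 1 + 1)))"
    using assms by (intro nn_integral_has_integral_lebesgue' has_integral_mult_right has_integral_powr_from_0) auto
  finally show ?thesis by simp
qed

text \<open>Evaluates the tail of the power test function; the bound on \<open>\<gamma>\<close>
  makes the radial integral converge at infinity.\<close>

lemma nn_integral_norm_powr_outside_ball:
  assumes "real DIM('a) < \<gamma>"
  shows "(\<integral>\<^sup>+x. ennreal (norm (x::'a::euclidean_space) powr (- \<gamma>)) * indicator (- ball 0 1) x \<partial>lborel) =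
    ennreal (unit_ball_vol DIM('a) * DIM('a) / (\<gamma> - DIM('a)))"
proof -
  have "(\<integral>\<^sup>+x. ennreal (norm (x::'a) powr (- \<gamma>)) * indicator (- ball 0 1) x \<partial>lborel)
     = (\<integral>\<^sup>+x. ennreal (norm (x::'a) powr (- \<gamma>)) * indicator {1..} (norm x) \<partial>lborel)"
    by (auto intro!: nn_integral_cong split: split_indicator)
  also have "\<dots> = (\<integral>\<^sup>+t. ennreal (unit_ball_vol DIM('a) * DIM('a) * t ^ (DIM('a) - 1)) * indicator {0..} t
      * (ennreal (t powr (- \<gamma>)) * indicator {1..} t) \<partial>lborel)"
    by (rule nn_integral_radial) measurable
  also have "\<dots> = (\<integral>\<^sup>+t. ennreal (unit_ball_vol DIM('a) * DIM('a) * t powr (DIM('a) - 1 - \<gamma>)) * indicator {1..} t \<partial>lborel)"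
  proof (intro nn_integral_cong)
    fix t :: real
    have "t ^ (DIM('a) - 1) * t powr (- \<gamma>) = t powr (DIM('a) - 1 - \<gamma>)" if "t \<ge> 1"
      using that by (simp flip: powr_realpow powr_add add: of_nat_diff Suc_leI)
    then show "ennreal (unit_ball_vol DIM('a) * DIM('a) * t ^ (DIM('a) - 1)) * indicator {0..} t
      * (ennreal (t powr (- \<gamma>)) * indicator {1..} t)
      = ennreal (unit_ball_vol DIM('a) * DIM('a) * t powr (DIM('a) - 1 - \<gamma>)) * indicator {1..} t"
      by (auto simp: mult.assoc simp flip: ennreal_mult split: split_indicator)
  qed
  also have "\<dots> = ennreal (unit_ball_vol DIM('a) * DIM('a) * (1 / (\<gamma> - DIM('a))))"
  proof (intro nn_integral_has_integral_lebesgue' has_integral_mult_right)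
    have "- (1 powr (DIM('a) - 1 - \<gamma> + 1)) / (DIM('a) - 1 - \<gamma> + 1) = 1 / (\<gamma> - DIM('a))"
      using assms by (simp add: field_simps)
    then show "((\<lambda>t. t powr (DIM('a) - 1 - \<gamma>)) has_integral (1 / (\<gamma> - DIM('a)))) {1..}"
      using assms has_integral_powr_to_inf[of "DIM('a) - 1 - \<gamma>" 1] by simp
  qed auto
  finally show ?thesis by simp
qed

section \<open>From nonnegative integrals to lower bounds for the best constant\<close>

text \<open>A Bochner integral that diverges has the value \<open>0\<close>, so \<open>fin\<close>
  is what makes \<open>riesz_B\<close> agree with the iterated nonnegative integral.\<close>

lemma riesz_B_eq_nn_integral:
  fixes f g :: "real ^ 'n \<Rightarrow> real"
  assumes [measurable]: "f \<in> borel_measurable borel" "g \<in> borel_measurable borel"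
    and nn: "\<And>x. 0 \<le> f x" "\<And>x. 0 \<le> g x"
    and fin: "(\<integral>\<^sup>+y. (\<integral>\<^sup>+x. ennreal (f y * g x / norm (x - y) powr (real CARD('n) - \<alpha>)) \<partial>lborel) \<partial>lborel) < \<infinity>"
  shows "ennreal (riesz_B \<alpha> f g) =
    (\<integral>\<^sup>+y. (\<integral>\<^sup>+x. ennreal (f y * g x / norm (x - y) powr (real CARD('n) - \<alpha>)) \<partial>lborel) \<partial>lborel)"
proof -
  let ?k = "\<lambda>y x. f y * g x / norm (x - y) powr (real CARD('n) - \<alpha>)"
  let ?I = "\<lambda>y. \<integral>\<^sup>+x. ennreal (?k y x) \<partial>lborel"
  \<comment> \<open>Valid for every \<open>y\<close>, even where \<open>?I y\<close> is infinite:
    both sides are then \<open>0\<close>.\<close>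
  have inner: "(LINT x|lebesgue. ?k y x) = enn2real (?I y)" for y
    by (subst integral_completion, measurable) (intro integral_eq_nn_integral, auto simp: nn)
  \<comment> \<open>Such \<open>y\<close> form a null set, so \<open>enn2real\<close> loses nothing
    under the outer integral.\<close>
  have "AE y in lborel. ?I y \<noteq> \<infinity>"
    using fin by (intro nn_integral_noteq_infinite) auto
  then have I: "(\<integral>\<^sup>+y. ennreal (enn2real (?I y)) \<partial>lborel) = (\<integral>\<^sup>+y. ?I y \<partial>lborel)"
    by (intro nn_integral_cong_AE) (auto simp: top.not_eq_extremum)
  have "riesz_B \<alpha> f g = (LINT y|lborel. enn2real (?I y))"
    unfolding riesz_B_def inner by (intro integral_completion) measurable
  also have "\<dots> = enn2real (\<integral>\<^sup>+y. ?I y \<partial>lborel)"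
    by (subst integral_eq_nn_integral) (auto simp: I)
  finally show ?thesis using fin by simp
qed

lemma Lp_nonzero_of_nn_integral:
  fixes f :: "real ^ 'n \<Rightarrow> real"
  assumes [measurable]: "f \<in> borel_measurable borel"
    and nn: "\<And>x. 0 \<le> f x"
    and P: "(\<integral>\<^sup>+x. ennreal (f x powr p) \<partial>lborel) = ennreal P" "P > 0"
  shows "f \<in> Lp_nonzero p" and "Lp_norm p f = P powr (1 / p)"
proof -
  have P': "(\<integral>\<^sup>+x. ennreal (\<bar>f x\<bar> powr p) \<partial>lebesgue) = ennreal P"
    using P nn by (simp add: nn_integral_completion)
  have [measurable]: "f \<in> borel_measurable lebesgue"
    by (rule measurable_completion) simp
  have int: "integrable lebesgue (\<lambda>x. \<bar>f x\<bar> powr p)"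
    using P' by (intro integrableI_nonneg) auto
  have "\<not> (AE x in lebesgue. f x = 0)"
  proof
    assume "AE x in lebesgue. f x = 0"
    then have "(\<integral>\<^sup>+x. ennreal (\<bar>f x\<bar> powr p) \<partial>lebesgue) = (\<integral>\<^sup>+(x::real^'n). 0 \<partial>lebesgue)"
      by (intro nn_integral_cong_AE) auto
    then show False using P' P(2) by simp
  qed
  with int show "f \<in> Lp_nonzero p" by (simp add: Lp_nonzero_def Lp_def)
  have "(LINT x|lebesgue. \<bar>f x\<bar> powr p) = P"
    using P' P(2) by (subst integral_eq_nn_integral) auto
  then show "Lp_norm p f = P powr (1 / p)" by (simp add: Lp_norm_def)
qed

text \<open>A single test pair bounds the supremum from below. The second conclusion tests with the
  pair exchanged; Tonelli and the symmetry of the kernel leave the value of the functional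
  unchanged.\<close>

lemma riesz_V_lower_bound:
  fixes f g :: "real ^ 'n \<Rightarrow> real"
  assumes [measurable]: "f \<in> borel_measurable borel" "g \<in> borel_measurable borel"
    and nn: "\<And>x. 0 \<le> f x" "\<And>x. 0 \<le> g x"
    and P: "(\<integral>\<^sup>+x. ennreal (f x powr r) \<partial>lborel) = ennreal P" "P > 0"
    and Q: "(\<integral>\<^sup>+x. ennreal (g x powr s) \<partial>lborel) = ennreal Q" "Q > 0"
    and fin: "(\<integral>\<^sup>+y. (\<integral>\<^sup>+x. ennreal (f y * g x / norm (x - y) powr (real CARD('n) - \<alpha>)) \<partial>lborel) \<partial>lborel) < \<infinity>"
    and c: "0 < c" "ennreal c \<le> (\<integral>\<^sup>+y. (\<integral>\<^sup>+x. ennreal (f y * g x / norm (x - y) powr (real CARD('n) - \<alpha>)) \<partial>lborel) \<partial>lborel)"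
  shows "ereal (c / (P powr (1 / r) * Q powr (1 / s))) \<le> riesz_V TYPE('n) \<alpha> r s"
    and "ereal (c / (P powr (1 / r) * Q powr (1 / s))) \<le> riesz_V TYPE('n) \<alpha> s r"
proof -
  note f = Lp_nonzero_of_nn_integral[OF assms(1) nn(1) P]
  note g = Lp_nonzero_of_nn_integral[OF assms(2) nn(2) Q]
  have swap: "(\<integral>\<^sup>+y. (\<integral>\<^sup>+x. ennreal (g y * f x / norm (x - y) powr (real CARD('n) - \<alpha>)) \<partial>lborel) \<partial>lborel)
    = (\<integral>\<^sup>+y. (\<integral>\<^sup>+x. ennreal (f y * g x / norm (x - y) powr (real CARD('n) - \<alpha>)) \<partial>lborel) \<partial>lborel)"
    by (subst lborel_pair.Fubini') (simp_all add: mult.commute norm_minus_commute)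
  \<comment> \<open>As \<open>ennreal\<close> sends negative numbers to \<open>0\<close>, the
    comparison returns to the reals only because \<open>c\<close> is positive.\<close>
  have B: "c \<le> riesz_B \<alpha> f g" "c \<le> riesz_B \<alpha> g f"
    using c riesz_B_eq_nn_integral[OF assms(1,2) nn fin]
      riesz_B_eq_nn_integral[OF assms(2,1) nn(2,1) fin[folded swap]]
    unfolding swap by (metis ennreal_le_iff2 less_le_not_le)+
  have "ereal (c / (P powr (1 / r) * Q powr (1 / s))) \<le> ereal (riesz_B \<alpha> f g / (Lp_norm r f * Lp_norm s g))"
    using B by (simp add: f(2) g(2) divide_right_mono)
  also have "\<dots> \<le> riesz_V TYPE('n) \<alpha> r s"
    unfolding riesz_V_def by (intro SUP_upper2[OF f(1)] SUP_upper2[OF g(1)] order_refl)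
  finally show "ereal (c / (P powr (1 / r) * Q powr (1 / s))) \<le> riesz_V TYPE('n) \<alpha> r s" .
  have "ereal (c / (P powr (1 / r) * Q powr (1 / s))) \<le> ereal (riesz_B \<alpha> g f / (Lp_norm s g * Lp_norm r f))"
    using B by (simp add: f(2) g(2) divide_right_mono mult.commute)
  also have "\<dots> \<le> riesz_V TYPE('n) \<alpha> s r"
    unfolding riesz_V_def by (intro SUP_upper2[OF f(1)] SUP_upper2[OF g(1)] order_refl)
  finally show "ereal (c / (P powr (1 / r) * Q powr (1 / s))) \<le> riesz_V TYPE('n) \<alpha> s r" .
qed

section \<open>The two test pairs\<close>

lemma nn_integral_lborel_translate:
  fixes h :: "'a::euclidean_space \<Rightarrow> ennreal"
  assumes [measurable]: "h \<in> borel_measurable borel"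
  shows "(\<integral>\<^sup>+x. h (x - y) \<partial>lborel) = (\<integral>\<^sup>+x. h x \<partial>lborel)"
proof -
  have "(\<integral>\<^sup>+x. h (x - y) \<partial>lborel) = (\<integral>\<^sup>+x. h (x - y) \<partial>distr lborel borel ((+) y))"
    by (simp add: lborel_distr_plus)
  also have "\<dots> = (\<integral>\<^sup>+x. h x \<partial>lborel)"
    by (subst nn_integral_distr) auto
  finally show ?thesis .
qed

lemma nn_integral_indicator_ball_powr:
  assumes "0 \<le> \<rho>"
  shows "(\<integral>\<^sup>+x. ennreal (indicator (ball (0::'a::euclidean_space) \<rho>) x powr p) \<partial>lborel)
    = ennreal (unit_ball_vol DIM('a) * \<rho> ^ DIM('a))"
proof -
  have "(\<integral>\<^sup>+x. ennreal (indicator (ball (0::'a) \<rho>) x powr p) \<partial>lborel)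
    = (\<integral>\<^sup>+x. indicator (ball (0::'a) \<rho>) x \<partial>lborel)"
    by (intro nn_integral_cong) (auto split: split_indicator)
  with assms show ?thesis by (simp add: emeasure_ball)
qed

text \<open>For \<open>norm y < 1/2\<close> the ball of radius \<open>1/2\<close> about
  \<open>y\<close> lies in the unit ball. The inner integral is therefore at least that of the
  kernel over this ball, which does not depend on \<open>y\<close>; the outer integral contributes
  the volume \<open>v * (1/2) powr d\<close>.\<close>

lemma riesz_V_ge_balls:
  fixes \<alpha> r s :: real
  defines "d \<equiv> real CARD('n::finite)" and "v \<equiv> unit_ball_vol (real CARD('n))"
  assumes \<alpha>: "0 < \<alpha>"
  defines "b \<equiv> v * (1/2) powr d * (v * d / \<alpha> * (1/2) powr \<alpha>)
     / ((v * (1/2) powr d) powr (1 / r) * v powr (1 / s))"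
  shows "ereal b \<le> riesz_V TYPE('n) \<alpha> r s" and "ereal b \<le> riesz_V TYPE('n) \<alpha> s r"
proof -
  define f g :: "real^'n \<Rightarrow> real" where "f = indicator (ball 0 (1/2))" and "g = indicator (ball 0 1)"
  have meas [measurable]: "f \<in> borel_measurable borel" "g \<in> borel_measurable borel"
    unfolding f_def g_def by (simp_all add: borel_measurable_indicator)
  have d: "d > 0" and v: "v > 0" by (simp_all add: d_def v_def)
  have half: "(1/2) ^ CARD('n) = (1/2) powr d" by (simp add: d_def powr_realpow)
  let ?h = "\<lambda>\<rho> x::real^'n. ennreal (norm x powr (\<alpha> - real CARD('n))) * indicator (ball 0 \<rho>) x"
  let ?I = "\<lambda>y. \<integral>\<^sup>+x. ennreal (f y * g x / norm (x - y) powr (real CARD('n) - \<alpha>)) \<partial>lborel"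
  have h: "(\<integral>\<^sup>+x. ?h \<rho> (x - y) \<partial>lborel) = ennreal (v * d / \<alpha> * \<rho> powr \<alpha>)" if "\<rho> > 0" for \<rho> y
    using nn_integral_norm_powr_ball[where 'a = "real^'n", OF that \<alpha>]
    by (subst nn_integral_lborel_translate) (measurable, simp_all add: d_def v_def)
  \<comment> \<open>This includes \<open>x = y\<close>, where both sides are \<open>0\<close> by
    convention.\<close>
  have k: "1 / norm (x - y) powr (real CARD('n) - \<alpha>) = norm (x - y) powr (\<alpha> - real CARD('n))"
    for x y :: "real^'n"
    by (simp flip: powr_minus_divide)
  have hi: "(\<integral>\<^sup>+x. ?h \<rho> (x - y) * indicator (ball 0 (1/2)) y \<partial>lborel)
      = ennreal (v * d / \<alpha> * \<rho> powr \<alpha>) * indicator (ball 0 (1/2)) y" if "\<rho> > 0" for \<rho> and y :: "real^'n"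
    using h[OF that, of y] by (cases "y \<in> ball 0 (1/2)") simp_all
  have low: "?h (1/2) (x - y) * indicator (ball 0 (1/2)) y
      \<le> ennreal (f y * g x / norm (x - y) powr (real CARD('n) - \<alpha>))" for x y
  proof -
    have "norm x < 1" if "norm (x - y) < 1/2" "norm y < 1/2"
      using norm_triangle_ineq[of "x - y" y] that by simp
    then show ?thesis using k[of x y]
      by (auto simp: f_def g_def split: split_indicator)
  qed
  \<comment> \<open>Serves only to show that the double integral is finite, so the radius
    \<open>2\<close> need not be sharp.\<close>
  have up: "ennreal (f y * g x / norm (x - y) powr (real CARD('n) - \<alpha>))
      \<le> ?h 2 (x - y) * indicator (ball 0 (1/2)) y" for x y
  proof -
    have "norm (x - y) < 2" if "norm x < 1" "norm y < 1/2"
      using norm_triangle_ineq4[of x y] that by simp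
    then show ?thesis using k[of x y]
      by (auto simp: f_def g_def split: split_indicator)
  qed
  have B: "(\<integral>\<^sup>+y. ennreal c * indicator (ball 0 (1/2) :: (real^'n) set) y \<partial>lborel)
    = ennreal (v * (1/2) powr d * c)" if "c \<ge> 0" for c
    using that v half by (simp add: nn_integral_cmult_indicator emeasure_ball mult.commute v_def flip: ennreal_mult)
  have "ennreal (v * (1/2) powr d * (v * d / \<alpha> * (1/2) powr \<alpha>))
      = (\<integral>\<^sup>+y. (\<integral>\<^sup>+x. ?h (1/2) (x - y) * indicator (ball 0 (1/2)) y \<partial>lborel) \<partial>lborel)"
    using \<alpha> d v by (subst hi, simp, subst B) auto
  also have "\<dots> \<le> (\<integral>\<^sup>+y. ?I y \<partial>lborel)"
    by (intro nn_integral_mono low)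
  finally have c: "ennreal (v * (1/2) powr d * (v * d / \<alpha> * (1/2) powr \<alpha>)) \<le> (\<integral>\<^sup>+y. ?I y \<partial>lborel)" .
  have "(\<integral>\<^sup>+y. ?I y \<partial>lborel) \<le> (\<integral>\<^sup>+y. (\<integral>\<^sup>+x. ?h 2 (x - y) * indicator (ball 0 (1/2)) y \<partial>lborel) \<partial>lborel)"
    by (intro nn_integral_mono up)
  also have "\<dots> < \<infinity>"
    using \<alpha> d v by (subst hi, simp, subst B) auto
  finally have fin: "(\<integral>\<^sup>+y. ?I y \<partial>lborel) < \<infinity>" .
  have P: "(\<integral>\<^sup>+x. ennreal (f x powr r) \<partial>lborel) = ennreal (v * (1/2) powr d)"
    using half by (simp add: f_def nn_integral_indicator_ball_powr v_def)
  have Q: "(\<integral>\<^sup>+x. ennreal (g x powr s) \<partial>lborel) = ennreal v"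
    by (simp add: g_def nn_integral_indicator_ball_powr v_def)
  have nn: "0 \<le> f x" "0 \<le> g x" for x by (simp_all add: f_def g_def)
  show "ereal b \<le> riesz_V TYPE('n) \<alpha> r s" "ereal b \<le> riesz_V TYPE('n) \<alpha> s r"
    unfolding b_def using riesz_V_lower_bound[OF meas nn P _ Q _ fin _ c] v d \<alpha> by simp_all
qed

text \<open>On the two supports \<open>norm (x - y)\<close> is comparable with
  \<open>norm x\<close>, so the double integral decouples. The exponent of \<open>g\<close> is the
  equality case of Hoelder's inequality: \<open>g x powr s\<close> and
  \<open>g x * norm x powr (- (d - \<alpha>))\<close> are both
  \<open>norm x powr (- \<gamma>)\<close> outside the unit ball, and \<open>J\<close> is the
  integral of that power there.\<close>

lemma riesz_V_ge_ball_power: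
  fixes \<alpha> r s :: real
  defines "d \<equiv> real CARD('n::finite)" and "v \<equiv> unit_ball_vol (real CARD('n))"
  assumes \<alpha>: "\<alpha> < d" and s: "1 < s"
  defines "\<gamma> \<equiv> (d - \<alpha>) * s / (s - 1)"
  assumes \<gamma>: "d < \<gamma>"
  defines "J \<equiv> v * d / (\<gamma> - d)"
  defines "b \<equiv> v * (1/2) powr d * ((2/3) powr (d - \<alpha>) * J)
     / ((v * (1/2) powr d) powr (1 / r) * J powr (1 / s))"
  shows "ereal b \<le> riesz_V TYPE('n) \<alpha> r s" and "ereal b \<le> riesz_V TYPE('n) \<alpha> s r"
proof -
  define f g :: "real^'n \<Rightarrow> real"
    where "f = indicator (ball 0 (1/2))"
      and "g = (\<lambda>x. norm x powr (- ((d - \<alpha>) / (s - 1))) * indicator (- ball 0 1) x)"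
  have meas [measurable]: "f \<in> borel_measurable borel" "g \<in> borel_measurable borel"
    unfolding f_def g_def by (simp_all add: borel_measurable_indicator)
  have d: "d > 0" and v: "v > 0" by (simp_all add: d_def v_def)
  then have J: "J > 0" using \<gamma> by (simp add: J_def)
  have half: "(1/2) ^ CARD('n) = (1/2) powr d" by (simp add: d_def powr_realpow)
  let ?h = "\<lambda>x::real^'n. ennreal (norm x powr (- \<gamma>)) * indicator (- ball 0 1) x"
  let ?I = "\<lambda>y. \<integral>\<^sup>+x. ennreal (f y * g x / norm (x - y) powr (real CARD('n) - \<alpha>)) \<partial>lborel"
  have h: "(\<integral>\<^sup>+x. ?h x \<partial>lborel) = ennreal J"
    using nn_integral_norm_powr_outside_ball[where 'a = "real^'n" and \<gamma> = \<gamma>] \<gamma>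
    by (simp add: d_def v_def J_def)
  have \<gamma>_eq: "(d - \<alpha>) / (s - 1) + (d - \<alpha>) = \<gamma>"
    using s by (simp add: \<gamma>_def field_simps)
  have h_eq: "norm x powr (- \<gamma>) = norm x powr (- ((d - \<alpha>) / (s - 1))) * norm x powr (- (d - \<alpha>))" for x :: "real^'n"
    by (simp flip: powr_add \<gamma>_eq)
  \<comment> \<open>Here \<open>norm y < 1/2 \<le> norm x / 2\<close>, whence
    \<open>norm (x - y)\<close> lies between \<open>norm x / 2\<close> and
    \<open>3/2 * norm x\<close>. The upper bound is needed for finiteness only.\<close>
  have bounds: "norm (x - y) powr (- (d - \<alpha>)) \<le> 2 powr (d - \<alpha>) * norm x powr (- (d - \<alpha>))"
      "(2/3) powr (d - \<alpha>) * norm x powr (- (d - \<alpha>)) \<le> norm (x - y) powr (- (d - \<alpha>))"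
    if "norm x \<ge> 1" "norm y < 1/2" for x y :: "real^'n"
  proof -
    have 1: "norm x / 2 \<le> norm (x - y)" using that norm_triangle_ineq2[of x y] by simp
    have 2: "norm (x - y) \<le> 3/2 * norm x" using that norm_triangle_ineq4[of x y] by simp
    have "norm (x - y) powr (- (d - \<alpha>)) \<le> (norm x / 2) powr (- (d - \<alpha>))"
      using 1 \<alpha> that by (intro powr_mono2') auto
    also have "\<dots> = 2 powr (d - \<alpha>) * norm x powr (- (d - \<alpha>))"
      by (simp only: powr_minus powr_divide) (simp add: field_simps)
    finally show "norm (x - y) powr (- (d - \<alpha>)) \<le> 2 powr (d - \<alpha>) * norm x powr (- (d - \<alpha>))" .
    have "(2/3) powr (d - \<alpha>) * norm x powr (- (d - \<alpha>)) = (3/2 * norm x) powr (- (d - \<alpha>))"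
      by (simp only: powr_minus powr_mult powr_divide) (simp add: field_simps)
    also have "\<dots> \<le> norm (x - y) powr (- (d - \<alpha>))"
      using 1 2 \<alpha> that by (intro powr_mono2') auto
    finally show "(2/3) powr (d - \<alpha>) * norm x powr (- (d - \<alpha>)) \<le> norm (x - y) powr (- (d - \<alpha>))" .
  qed
  have k: "z / norm (x - y) powr (real CARD('n) - \<alpha>) = z * norm (x - y) powr (- (d - \<alpha>))"
    for x y :: "real^'n" and z
    by (simp only: powr_minus d_def divide_inverse)
  have low: "ennreal ((2/3) powr (d - \<alpha>)) * ?h x * indicator (ball 0 (1/2)) y
      \<le> ennreal (f y * g x / norm (x - y) powr (real CARD('n) - \<alpha>))" for x y
    using bounds(2)[of x y] mult_left_mono[of "(2/3) powr (d - \<alpha>) * norm x powr (- (d - \<alpha>))"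
        "norm (x - y) powr (- (d - \<alpha>))" "norm x powr (- ((d - \<alpha>) / (s - 1)))"]
    unfolding k h_eq
    by (auto simp: f_def g_def mult_ac simp flip: ennreal_mult split: split_indicator)
  have up: "ennreal (f y * g x / norm (x - y) powr (real CARD('n) - \<alpha>))
      \<le> ennreal (2 powr (d - \<alpha>)) * ?h x * indicator (ball 0 (1/2)) y" for x y
    using bounds(1)[of x y] mult_left_mono[of "norm (x - y) powr (- (d - \<alpha>))"
        "2 powr (d - \<alpha>) * norm x powr (- (d - \<alpha>))" "norm x powr (- ((d - \<alpha>) / (s - 1)))"]
    unfolding k h_eq
    by (auto simp: f_def g_def mult_ac simp flip: ennreal_mult split: split_indicator)
  have B: "(\<integral>\<^sup>+y. (\<integral>\<^sup>+x. ennreal c * ?h x * indicator (ball (0::real^'n) (1/2)) y \<partial>lborel) \<partial>lborel)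
    = ennreal (v * (1/2) powr d * (c * J))" if "c \<ge> 0" for c
  proof -
    have "(\<integral>\<^sup>+x. ennreal c * ?h x * indicator (ball 0 (1/2)) y \<partial>lborel)
        = ennreal (c * J) * indicator (ball 0 (1/2)) y" for y :: "real^'n"
    proof -
      have "(\<integral>\<^sup>+x. ennreal c * ?h x \<partial>lborel) = ennreal (c * J)"
        using that J h by (subst nn_integral_cmult) (measurable, simp add: ennreal_mult)
      then show ?thesis by (cases "y \<in> ball 0 (1/2)") simp_all
    qed
    then have "(\<integral>\<^sup>+y. (\<integral>\<^sup>+x. ennreal c * ?h x * indicator (ball (0::real^'n) (1/2)) y \<partial>lborel) \<partial>lborel)
        = (\<integral>\<^sup>+y. ennreal (c * J) * indicator (ball 0 (1/2) :: (real^'n) set) y \<partial>lborel)"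
      by (simp only:)
    then show ?thesis
      using that v half J
      by (simp add: nn_integral_cmult_indicator emeasure_ball mult.commute v_def flip: ennreal_mult)
  qed
  have "ennreal (v * (1/2) powr d * ((2/3) powr (d - \<alpha>) * J))
      = (\<integral>\<^sup>+y. (\<integral>\<^sup>+x. ennreal ((2/3) powr (d - \<alpha>)) * ?h x * indicator (ball (0::real^'n) (1/2)) y \<partial>lborel) \<partial>lborel)"
    by (rule B[symmetric]) simp
  also have "\<dots> \<le> (\<integral>\<^sup>+y. ?I y \<partial>lborel)"
    by (intro nn_integral_mono low)
  finally have c: "ennreal (v * (1/2) powr d * ((2/3) powr (d - \<alpha>) * J)) \<le> (\<integral>\<^sup>+y. ?I y \<partial>lborel)" .
  have "(\<integral>\<^sup>+y. ?I y \<partial>lborel)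
      \<le> (\<integral>\<^sup>+y. (\<integral>\<^sup>+x. ennreal (2 powr (d - \<alpha>)) * ?h x * indicator (ball (0::real^'n) (1/2)) y \<partial>lborel) \<partial>lborel)"
    by (intro nn_integral_mono up)
  also have "\<dots> < \<infinity>"
    by (subst B) simp_all
  finally have fin: "(\<integral>\<^sup>+y. ?I y \<partial>lborel) < \<infinity>" .
  have P: "(\<integral>\<^sup>+x. ennreal (f x powr r) \<partial>lborel) = ennreal (v * (1/2) powr d)"
    using half by (simp add: f_def nn_integral_indicator_ball_powr v_def)
  have Q: "(\<integral>\<^sup>+x. ennreal (g x powr s) \<partial>lborel) = ennreal J"
    unfolding h[symmetric]
    by (intro nn_integral_cong) (auto simp: g_def powr_powr \<gamma>_def split: split_indicator)
  have nn: "0 \<le> f x" "0 \<le> g x" for x by (simp_all add: f_def g_def)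
  show "ereal b \<le> riesz_V TYPE('n) \<alpha> r s" "ereal b \<le> riesz_V TYPE('n) \<alpha> s r"
    unfolding b_def using riesz_V_lower_bound[OF meas nn P _ Q _ fin _ c] v J by simp_all
qed

section \<open>An upper bound for the explicit constant\<close>

text \<open>The case \<open>k = 0\<close> comes from \<open>omega (d - 1)\<close> at
  \<open>d = 1\<close>; as \<open>Gamma 0 = 0\<close>, division by zero makes \<open>omega 0\<close>
  vanish.\<close>

lemma omega_nonneg: "0 \<le> omega k"
  by (cases "k = 0") (simp_all add: omega_def Gamma_real_pos less_imp_le)

lemma unit_ball_vol_eq_omega: "0 < d \<Longrightarrow> unit_ball_vol (real d) = omega d / real d"
proof -
  assume "0 < d"
  then have "real d / 2 \<notin> \<int>\<^sub>\<le>\<^sub>0" using nonpos_Ints_nonpos[of "real d / 2"] by auto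
  from Gamma_plus1[OF this] show ?thesis
    unfolding unit_ball_vol_def omega_def by (simp only:) (simp add: mult.commute)
qed

text \<open>The infimum defining \<open>R\<close> is bounded by its value at \<open>p = 1\<close>, where the \<open>A\<close>- and \<open>a\<close>-terms
  vanish.\<close>

lemma riesz_R_le:
  fixes \<alpha> :: real and d :: nat
  defines "v \<equiv> omega d / real d" and "\<kappa> \<equiv> \<alpha> / real d" and "z \<equiv> 1 - \<alpha> / real d"
  assumes d: "0 < d" and \<alpha>: "0 < \<alpha>" "\<alpha> < real d"
  shows "riesz_R \<alpha> d \<le> v powr z * (2/3 * 5 powr (- (real d * z)) * (z\<^sup>2 / \<kappa>) powr z)"
proof -
  have \<kappa>: "0 < \<kappa>" "\<kappa> < 1" and z: "0 < z" "z < 1" "z = 1 - \<kappa>" and \<alpha>_eq: "\<alpha> = real d * \<kappa>"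
    and dz: "real d * z = real d - \<alpha>"
    using d \<alpha> by (auto simp: \<kappa>_def z_def field_simps)
  have v: "v > 0" using d unfolding v_def by (simp flip: unit_ball_vol_eq_omega)
  have q: "real d / \<alpha> - 1 = z / \<kappa>"
    using d \<alpha> by (simp add: z_def \<kappa>_def field_simps)
  have nonneg: "0 \<le> riesz_A \<alpha> d" "0 \<le> riesz_D \<alpha> d" "0 \<le> riesz_a \<alpha> d" "0 \<le> riesz_n \<alpha> d"
    using \<alpha> by (simp_all add: riesz_A_def riesz_D_def riesz_a_def riesz_n_def riesz_m_def omega_nonneg le_max_iff_disj)
  \<comment> \<open>Nonnegative constants make \<open>riesz_F\<close> bounded below by
    \<open>0\<close>, so that the real infimum lies below each of its values.\<close>
  have "riesz_R \<alpha> d \<le> riesz_F \<alpha> d 1"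
    unfolding riesz_R_def
  proof (rule cINF_lower)
    show "bdd_below (riesz_F \<alpha> d ` {1..real d / \<alpha>})"
      by (rule bdd_belowI2[where m = 0]) (simp add: riesz_F_def nonneg)
    show "1 \<in> {1..real d / \<alpha>}" using \<alpha> by simp
  qed
  \<comment> \<open>At \<open>p = 1\<close> the exponents of \<open>z / \<kappa>\<close> are
    \<open>3 - \<kappa>\<close> in the numerator and \<open>\<kappa>\<close> in the
    denominator.\<close>
  also have "riesz_F \<alpha> d 1 = 1/2 * (riesz_D \<alpha> d / riesz_n \<alpha> d) * (z / \<kappa>) powr (3 - 2 * \<kappa>)"
  proof -
    have "(2 * real d - \<alpha>) / real d = 2 - \<kappa>" using d by (simp add: \<kappa>_def field_simps)
    moreover have "(z / \<kappa>) powr (3 - \<kappa>) = (z / \<kappa>) powr (3 - 2 * \<kappa>) * (z / \<kappa>) powr \<kappa>"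
      by (simp flip: powr_add)
    ultimately show ?thesis
      unfolding riesz_F_def q using z \<kappa> by (simp flip: \<kappa>_def)
  qed
  \<comment> \<open>The minimum in \<open>riesz_D\<close> is at most \<open>1\<close>, and the
    powers of \<open>d\<close> combine to \<open>d powr (- 1 - \<kappa>) \<le> 1\<close>. Dividing
    by \<open>riesz_n\<close>, which is at least \<open>v powr \<kappa>\<close>, turns the factor
    \<open>v\<close> into \<open>v powr z\<close>.\<close>
  also have "\<dots> \<le> 1/2 * (4/3 * 5 powr (- (real d * z)) * v powr z * \<kappa> powr (2 + \<kappa>)) * (z / \<kappa>) powr (3 - 2 * \<kappa>)"
  proof (intro mult_right_mono mult_left_mono)
    have "riesz_D \<alpha> d \<le> 1/3 * 4 * 5 powr (\<alpha> - real d) * omega d * 1 * ((real d)\<^sup>2 / \<alpha>) powr (- 2 - \<alpha> / real d)"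
      unfolding riesz_D_def by (intro mult_right_mono mult_left_mono) (auto simp: omega_nonneg)
    also have "\<dots> = 4/3 * 5 powr (- (real d * z)) * v * (real d * (real d / \<kappa>) powr (- 2 - \<kappa>))"
      using d \<kappa> unfolding dz by (simp add: v_def \<alpha>_eq power2_eq_square)
    also have "\<dots> \<le> 4/3 * 5 powr (- (real d * z)) * v * \<kappa> powr (2 + \<kappa>)"
    proof -
      have "real d * (real d / \<kappa>) powr (- 2 - \<kappa>) = real d powr (- 1 - \<kappa>) * \<kappa> powr (2 + \<kappa>)"
      proof -
        have "real d * real d powr (- 2 - \<kappa>) = real d powr (- 1 - \<kappa>)"
          using d by (simp add: powr_mult_base)
        moreover have "\<kappa> powr (- 2 - \<kappa>) = 1 / \<kappa> powr (2 + \<kappa>)"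
          by (simp flip: powr_minus_divide)
        ultimately show ?thesis using \<kappa> d by (simp add: powr_divide)
      qed
      also have "\<dots> \<le> 1 * \<kappa> powr (2 + \<kappa>)"
        using d \<kappa> powr_mono[of "- 1 - \<kappa>" 0 "real d"] by (intro mult_right_mono) auto
      finally show ?thesis using v by (intro mult_left_mono) auto
    qed
    also have "\<dots> = (4/3 * 5 powr (- (real d * z)) * v powr z * \<kappa> powr (2 + \<kappa>)) * v powr \<kappa>"
      using v powr_add[of v z \<kappa>] by (simp add: z(3))
    finally have "riesz_D \<alpha> d \<le> (4/3 * 5 powr (- (real d * z)) * v powr z * \<kappa> powr (2 + \<kappa>)) * v powr \<kappa>" .
    also have "\<dots> \<le> (4/3 * 5 powr (- (real d * z)) * v powr z * \<kappa> powr (2 + \<kappa>)) * riesz_n \<alpha> d"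
      by (intro mult_left_mono) (auto simp: riesz_n_def v_def \<kappa>_def)
    finally show "riesz_D \<alpha> d / riesz_n \<alpha> d \<le> 4/3 * 5 powr (- (real d * z)) * v powr z * \<kappa> powr (2 + \<kappa>)"
      using v by (subst pos_divide_le_eq) (auto simp: riesz_n_def v_def less_max_iff_disj)
  qed auto
  also have "\<dots> = v powr z * (2/3 * 5 powr (- (real d * z))) * (\<kappa> powr (2 + \<kappa>) * (z / \<kappa>) powr (3 - 2 * \<kappa>))"
    by simp
  also have "\<dots> \<le> v powr z * (2/3 * 5 powr (- (real d * z))) * (z\<^sup>2 / \<kappa>) powr z"
  proof (intro mult_left_mono)
    have "\<kappa> powr (2 + \<kappa>) * (z / \<kappa>) powr (3 - 2 * \<kappa>) = \<kappa> powr (2 * \<kappa> - z) * z powr (1 + 2 * z)"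
    proof -
      have "\<kappa> powr (2 + \<kappa>) / \<kappa> powr (3 - 2 * \<kappa>) = \<kappa> powr (2 * \<kappa> - z)"
        by (simp add: z(3) flip: powr_diff)
      moreover have "3 - 2 * \<kappa> = 1 + 2 * z" by (simp add: z(3))
      moreover have "\<kappa> powr (2 + \<kappa>) * (z / \<kappa>) powr (3 - 2 * \<kappa>)
          = \<kappa> powr (2 + \<kappa>) / \<kappa> powr (3 - 2 * \<kappa>) * z powr (3 - 2 * \<kappa>)"
        using z \<kappa> by (simp add: powr_divide)
      ultimately show ?thesis by metis
    qed
    \<comment> \<open>Both bases are below \<open>1\<close>, so decreasing the exponents increases
      the powers.\<close>
    also have "\<dots> \<le> \<kappa> powr (- z) * z powr (2 * z)"
      using z \<kappa> by (intro mult_mono powr_mono') auto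
    also have "\<dots> = (z\<^sup>2 / \<kappa>) powr z"
    proof -
      have "z powr (2 * z) = z powr z * z powr z" by (simp flip: powr_add)
      then show ?thesis by (simp add: powr_divide powr_minus_divide power2_eq_square powr_mult)
    qed
    finally show "\<kappa> powr (2 + \<kappa>) * (z / \<kappa>) powr (3 - 2 * \<kappa>) \<le> (z\<^sup>2 / \<kappa>) powr z" .
  qed auto
  finally show ?thesis by simp
qed

section \<open>Elementary inequalities between the constants\<close>

text \<open>Midpoint convexity of \<open>t * ln t\<close>, in exponential form. It follows from
  \<open>ln u \<le> u - 1\<close> at \<open>u = m / t\<close>, where \<open>m\<close> is the
  midpoint: the linear terms cancel on summing over \<open>t = x\<close> and
  \<open>t = y\<close>.\<close>

lemma powr_self_mult_ge:
  fixes x y :: real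
  assumes "0 < x" "0 < y"
  shows "((x + y) / 2) powr (x + y) \<le> x powr x * y powr y"
proof -
  define m where "m = (x + y) / 2"
  have m: "0 < m" using assms by (simp add: m_def)
  have "t * (ln m - ln t) \<le> m - t" if "0 < t" for t
    using that m ln_le_minus_one[of "m / t"] mult_left_mono[of "ln (m / t)" "m / t - 1" t]
    by (simp add: ln_div right_diff_distrib)
  from this[OF assms(1)] this[OF assms(2)]
  have "(x + y) * ln ((x + y) / 2) \<le> x * ln x + y * ln y"
    by (simp add: m_def algebra_simps)
  then have "exp ((x + y) * ln ((x + y) / 2)) \<le> exp (x * ln x + y * ln y)" by simp
  then show ?thesis using assms by (simp add: powr_def exp_add)
qed

context
  fixes x y \<kappa> z d :: real
  assumes pos: "0 < x" "0 < \<kappa>" and xy: "x \<le> y" and sum: "x + y + \<kappa> = 1" and d: "2 \<le> d"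
    and z: "z = x + y"
begin

text \<open>The factor \<open>(1/8) powr z\<close> is split as
  \<open>(1/4) powr z * (1/2) powr z\<close>: the first half pays for replacing
  \<open>z\<^sup>2\<close> by \<open>x * y\<close> with the help of \<open>(y / x) powr y\<close>,
  the second for replacing \<open>\<kappa>\<close> by \<open>(1 - x) * (1 - y)\<close>.\<close>

lemma constant_le_ball_power:
  assumes "x \<le> \<kappa>"
  shows "2/3 * 5 powr (- (d * z)) * (z\<^sup>2 / \<kappa>) powr z
    \<le> (1/2) powr (d * x) * (2/3) powr (d * z) * (y / x) powr y * (x / (1 - x) * (y / (1 - y))) powr z"
proof -
  have z01: "0 < z" "z < 1" and y: "0 < y" "y < 1" "z / 2 \<le> y" using pos xy sum z by auto
  \<comment> \<open>The base is \<open>50/9 = 1/2 * (2/3)\<^sup>2 * 5\<^sup>2\<close>, and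
    \<open>50/9 * 1/8 = 25/36\<close> just exceeds \<open>2/3\<close>. The bound
    \<open>d \<ge> 2\<close> gives \<open>z \<le> d * (z / 2)\<close>.\<close>
  have num: "2/3 * 5 powr (- (d * z)) \<le> (1/2) powr (d * (z / 2)) * (2/3) powr (d * z) * (1/8) powr z"
  proof -
    have "2/3 \<le> (25/36 :: real) powr 1" by simp
    also have "\<dots> \<le> (25/36) powr z" using z01 by (intro powr_mono') auto
    also have "\<dots> = (50/9) powr z * (1/8) powr z" by (simp flip: powr_mult)
    also have "\<dots> \<le> (50/9) powr (d * (z / 2)) * (1/8) powr z"
      using d z01 by (intro mult_right_mono powr_mono) auto
    also have "\<dots> = ((1/2) powr (d * (z / 2)) * (2/3) powr (d * z) * (1/8) powr z) * 5 powr (d * z)"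
    proof -
      have sq: "a powr (d * z) = (a * a) powr (d * (z / 2))" if "a > 0" for a :: real
        using that by (simp add: powr_mult flip: powr_add)
      have n: "50/9 = 1/2 * (2/3 * (2/3)) * (5 * 5 :: real)" by simp
      have "(50/9 :: real) powr (d * (z / 2))
          = (1/2) powr (d * (z / 2)) * (2/3 * (2/3)) powr (d * (z / 2)) * (5 * 5) powr (d * (z / 2))"
        by (simp only: n powr_mult)
      also have "\<dots> = (1/2) powr (d * (z / 2)) * (2/3) powr (d * z) * 5 powr (d * z)"
        by (subst (1 2) sq) simp_all
      finally show ?thesis by simp
    qed
    finally show ?thesis by (simp add: powr_minus_divide field_simps)
  qed
  have "(z\<^sup>2 / 4) powr z = (z / 2) powr z * (z / 2) powr z"
    using z01 by (simp add: power2_eq_square flip: powr_mult)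
  \<comment> \<open>One factor is bounded by convexity, the other by
    \<open>z / 2 \<le> y\<close>.\<close>
  also have "\<dots> \<le> (x powr x * y powr y) * y powr z"
    using powr_self_mult_ge[of x y] pos y z01 unfolding z
    by (intro mult_mono powr_mono2) auto
  also have "\<dots> = (y / x) powr y * (x * y) powr z"
    using pos y powr_add[of x x y] by (simp add: powr_divide powr_mult z)
  finally have xy_ge: "(z\<^sup>2 / 4) powr z \<le> (y / x) powr y * (x * y) powr z" .
  \<comment> \<open>Here \<open>x \<le> \<kappa>\<close> enters, through
    \<open>1 - y = x + \<kappa>\<close>.\<close>
  have "(1 - x) * (1 - y) \<le> 1 * (2 * \<kappa>)"
    using pos sum assms y by (intro mult_mono) auto
  then have den: "((1 - x) * (1 - y)) powr z \<le> (2 * \<kappa>) powr z"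
    using pos y sum z01 by (intro powr_mono2) auto
  have "(1/8) powr z * (z\<^sup>2 / \<kappa>) powr z = (z\<^sup>2 / 4) powr z / (2 * \<kappa>) powr z"
    using pos z01 by (simp add: mult_ac flip: powr_mult powr_divide)
  also have "\<dots> \<le> (y / x) powr y * (x * y) powr z / ((1 - x) * (1 - y)) powr z"
    using xy_ge den pos y sum by (intro frac_le) auto
  also have "\<dots> = (y / x) powr y * (x / (1 - x) * (y / (1 - y))) powr z"
    by (simp add: powr_divide powr_mult)
  finally have 1: "(1/8) powr z * (z\<^sup>2 / \<kappa>) powr z \<le> (y / x) powr y * (x / (1 - x) * (y / (1 - y))) powr z" .
  have 2: "(1/2) powr (d * (z / 2)) \<le> (1/2 :: real) powr (d * x)"
    using d xy z by (intro powr_mono' mult_left_mono) auto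
  have "2/3 * 5 powr (- (d * z)) * (z\<^sup>2 / \<kappa>) powr z
      \<le> (1/2) powr (d * (z / 2)) * (2/3) powr (d * z) * (1/8) powr z * (z\<^sup>2 / \<kappa>) powr z"
    by (intro mult_right_mono num) auto
  also have "\<dots> = (1/2) powr (d * (z / 2)) * (2/3) powr (d * z) * ((1/8) powr z * (z\<^sup>2 / \<kappa>) powr z)"
    by simp
  also have "\<dots> \<le> (1/2) powr (d * x) * (2/3) powr (d * z) * ((y / x) powr y * (x / (1 - x) * (y / (1 - y))) powr z)"
    by (intro mult_mono 1 2) auto
  finally show ?thesis by (simp add: mult_ac)
qed

text \<open>Now \<open>1 - y = x + \<kappa> < 2 * x\<close>, so the base of the last power is at
  least \<open>y / 2\<close>, hence at least \<open>z\<^sup>2 / 4\<close>. No growth factor in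
  \<open>y / x\<close> is required.\<close>

lemma constant_le_balls:
  assumes "\<kappa> < x"
  shows "2/3 * 5 powr (- (d * z)) * (z\<^sup>2 / \<kappa>) powr z
    \<le> 1 / \<kappa> * (1/2) powr (d * (\<kappa> + x)) * (x / (1 - x) * (y / (1 - y))) powr z"
proof -
  have z01: "0 < z" "z < 1" and y: "0 < y" "y < 1" "z / 2 \<le> y" using pos xy sum z by auto
  have "2/3 \<le> (25/16 :: real) powr 0" by simp
  also have "\<dots> \<le> (25/16) powr z" using z01 by (intro powr_mono) auto
  also have "\<dots> = (5/2) powr (2 * z) * (1/4) powr z"
  proof -
    have n: "25/16 = (5/2) powr 2 * (1/4 :: real)" by (simp add: power2_eq_square)
    show ?thesis by (simp only: n powr_mult powr_powr)
  qed
  also have "\<dots> \<le> (5/2) powr (d * z) * (1/4) powr z"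
    using d z01 by (intro mult_right_mono powr_mono) auto
  also have "\<dots> = (1/2) powr (d * z) * (1/4) powr z * 5 powr (d * z)"
    by (simp flip: powr_mult)
  finally have num: "2/3 * 5 powr (- (d * z)) \<le> (1/2) powr (d * z) * (1/4) powr z"
    by (simp add: powr_minus_divide field_simps)
  have "z\<^sup>2 / 4 \<le> y / 2"
    using y z01 power_le_one_iff[of z 2] power_decreasing[of 1 2 z] by simp
  also have "y / 2 = x * y / (1 * (2 * x))" using pos by simp
  also have "\<dots> \<le> x * y / ((1 - x) * (1 - y))"
    using pos y sum assms by (intro divide_left_mono mult_mono mult_pos_pos mult_nonneg_nonneg) auto
  finally have q: "z\<^sup>2 / 4 \<le> x / (1 - x) * (y / (1 - y))" by simp
  have "2/3 * 5 powr (- (d * z)) * (z\<^sup>2 / \<kappa>) powr z \<le> (1/2) powr (d * z) * (1/4) powr z * (z\<^sup>2 / \<kappa>) powr z"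
    by (intro mult_right_mono num) auto
  also have "\<dots> = (1 / \<kappa>) powr z * (1/2) powr (d * z) * (z\<^sup>2 / 4) powr z"
    using pos by (simp add: powr_mult powr_divide)
  \<comment> \<open>Uses \<open>1 / \<kappa> > 1\<close> with \<open>z < 1\<close>, and
    \<open>\<kappa> + x \<le> z\<close>, which holds because
    \<open>\<kappa> < x \<le> y\<close>.\<close>
  also have "\<dots> \<le> (1 / \<kappa>) powr 1 * (1/2) powr (d * (\<kappa> + x)) * (x / (1 - x) * (y / (1 - y))) powr z"
    using pos xy sum z z01 d assms
    by (intro mult_mono powr_mono powr_mono' powr_mono2 mult_left_mono q) auto
  finally show ?thesis using pos by simp
qed

end

section \<open>Assembling the two cases\<close>

text \<open>The order \<open>r \<le> s\<close> gives \<open>x \<le> y\<close>; the conclusion with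
  exchanged exponents covers the opposite order.\<close>

lemma riesz_V_ge_of_le:
  fixes \<alpha> r s :: real
  assumes d2: "2 \<le> CARD('n::finite)" and \<alpha>: "0 < \<alpha>" "\<alpha> < real CARD('n)"
    and rs: "1 < r" "1 < s" "r \<le> s" "1 / r + 1 / s = 1 + \<alpha> / real CARD('n)"
  defines "c \<equiv> ereal (riesz_R \<alpha> CARD('n) / ((r - 1) * (s - 1)) powr (1 - \<alpha> / real CARD('n)))"
  shows "c \<le> riesz_V TYPE('n) \<alpha> r s" and "c \<le> riesz_V TYPE('n) \<alpha> s r"
proof -
  define d v \<kappa> z x y where "d = real CARD('n)" and "v = unit_ball_vol d" and "\<kappa> = \<alpha> / d"
    and "z = 1 - \<kappa>" and "x = 1 - 1 / r" and "y = 1 - 1 / s"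
  note defs = this
  have d: "2 \<le> d" "0 < d" and v: "0 < v" using d2 by (simp_all add: d_def v_def)
  have \<kappa>: "0 < \<kappa>" and \<alpha>_eq: "\<alpha> = d * \<kappa>" using \<alpha> d by (simp_all add: \<kappa>_def)
  have x: "0 < x" and xy: "x \<le> y" and sum: "x + y + \<kappa> = 1"
    using rs by (auto simp: x_def y_def \<kappa>_def d_def frac_le)
  have z: "z = x + y" using sum by (simp add: z_def)
  have dz: "d - \<alpha> = d * z" using d by (simp add: \<alpha>_eq z_def algebra_simps)
  have r: "1 / r = 1 - x" and s: "1 / s = 1 - y" by (simp_all add: x_def y_def)
  have rs1: "r - 1 = x / (1 - x)" "s - 1 = y / (1 - y)"
    using rs by (simp_all add: x_def y_def field_simps)
  define Q where "Q = (x / (1 - x) * (y / (1 - y))) powr z"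
  have Q: "0 < Q" using x xy sum \<kappa> by (simp add: Q_def)
  have R: "riesz_R \<alpha> CARD('n) \<le> v powr z * (2/3 * 5 powr (- (d * z)) * (z\<^sup>2 / \<kappa>) powr z)"
    using riesz_R_le[of "CARD('n)" \<alpha>] \<alpha> d2
    by (simp add: unit_ball_vol_eq_omega v_def d_def z_def \<kappa>_def)
  \<comment> \<open>Both test pairs give a bound \<open>v powr z * b\<close>, and the estimate for
    \<open>R\<close> carries the same \<open>v powr z\<close>; what remains to prove is free of
    \<open>v\<close>.\<close>
  have c_le: "c \<le> ereal (v powr z * b)"
    if "2/3 * 5 powr (- (d * z)) * (z\<^sup>2 / \<kappa>) powr z \<le> b * Q" for b
  proof -
    have "c = ereal (riesz_R \<alpha> CARD('n) / Q)"
      unfolding c_def Q_def rs1 by (simp add: z_def \<kappa>_def d_def)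
    moreover have "riesz_R \<alpha> CARD('n) \<le> v powr z * (b * Q)"
      using R mult_left_mono[OF that, of "v powr z"] by simp
    ultimately show ?thesis using Q by (simp add: pos_divide_le_eq mult_ac)
  qed
  have cancel: "t / t powr (1 - a) = t powr a" if "0 < t" for t a :: real
    using that by (simp add: powr_diff)
  have vx: "v * (1/2) powr d / (v * (1/2) powr d) powr (1 / r) = v powr x * (1/2) powr (d * x)"
    unfolding r using v by (subst cancel) (simp_all add: powr_mult powr_powr)
  show "c \<le> riesz_V TYPE('n) \<alpha> r s" and "c \<le> riesz_V TYPE('n) \<alpha> s r"
  proof (atomize (full), cases "x \<le> \<kappa>")
    case True
    define \<gamma> J where "\<gamma> = (d - \<alpha>) * s / (s - 1)" and "J = v * d / (\<gamma> - d)"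
    have "\<gamma> = d * z / y"
      unfolding \<gamma>_def dz y_def using rs by (simp add: field_simps)
    \<comment> \<open>Since \<open>z - y = x\<close>. This puts \<open>y / x\<close> into
      \<open>J\<close>, and \<open>J powr y\<close> then supplies the factor
      \<open>(y / x) powr y\<close>.\<close>
    then have \<gamma>: "\<gamma> - d = d * x / y" using x xy by (simp add: z field_simps)
    have J: "J = v * (y / x)" "0 < J" unfolding J_def \<gamma> using d x xy v by simp_all
    have "d < \<gamma>" using \<gamma> d x xy by (smt (verit) divide_pos_pos mult_pos_pos)
    note V = riesz_V_ge_ball_power[where 'n = 'n and \<alpha> = \<alpha> and s = s and r = r,
        folded defs(1), folded defs(2) \<gamma>_def, folded J_def, OF _ _ this]
    have "v * (1/2) powr d * ((2/3) powr (d - \<alpha>) * J) / ((v * (1/2) powr d) powr (1 / r) * J powr (1 / s))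
      = (v * (1/2) powr d / (v * (1/2) powr d) powr (1 / r)) * (2/3) powr (d * z) * (J / J powr (1 / s))"
      by (simp add: dz)
    also have "\<dots> = v powr x * (1/2) powr (d * x) * (2/3) powr (d * z) * (v powr y * (y / x) powr y)"
      unfolding vx s cancel[OF J(2)] by (simp only: J powr_mult)
    also have "\<dots> = v powr z * ((1/2) powr (d * x) * (2/3) powr (d * z) * (y / x) powr y)"
      by (simp add: z powr_add)
    finally have "ereal (v powr z * ((1/2) powr (d * x) * (2/3) powr (d * z) * (y / x) powr y)) \<le> riesz_V TYPE('n) \<alpha> r s"
      "ereal (v powr z * ((1/2) powr (d * x) * (2/3) powr (d * z) * (y / x) powr y)) \<le> riesz_V TYPE('n) \<alpha> s r"
      using V \<alpha> rs by (simp_all add: d_def)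
    moreover have "c \<le> ereal (v powr z * ((1/2) powr (d * x) * (2/3) powr (d * z) * (y / x) powr y))"
      using constant_le_ball_power[OF x \<kappa> xy sum d(1) z True] by (intro c_le) (simp only: Q_def)
    ultimately show "c \<le> riesz_V TYPE('n) \<alpha> r s \<and> c \<le> riesz_V TYPE('n) \<alpha> s r"
      by (meson order_trans)
  next
    case False
    note V = riesz_V_ge_balls[where 'n = 'n and \<alpha> = \<alpha> and s = s and r = r,
        folded defs(1), folded defs(2), OF \<alpha>(1)]
    \<comment> \<open>With \<open>\<alpha> = d * \<kappa>\<close> the factor
      \<open>v * d / \<alpha>\<close> is \<open>v / \<kappa>\<close>, and the powers of
      \<open>1/2\<close> join to the exponent \<open>d * (\<kappa> + x)\<close>.\<close>
    have "v * (1/2) powr d * (v * d / \<alpha> * (1/2) powr \<alpha>) / ((v * (1/2) powr d) powr (1 / r) * v powr (1 / s))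
      = (v * (1/2) powr d / (v * (1/2) powr d) powr (1 / r)) * (1 / \<kappa>) * (1/2) powr (d * \<kappa>) * (v / v powr (1 / s))"
      using d by (simp add: \<alpha>_eq mult_ac)
    also have "\<dots> = v powr x * (1/2) powr (d * x) * (1 / \<kappa>) * (1/2) powr (d * \<kappa>) * v powr y"
      unfolding vx s cancel[OF v] ..
    also have "\<dots> = v powr z * (1 / \<kappa> * (1/2) powr (d * (\<kappa> + x)))"
      by (simp add: z powr_add distrib_left)
    finally have "ereal (v powr z * (1 / \<kappa> * (1/2) powr (d * (\<kappa> + x)))) \<le> riesz_V TYPE('n) \<alpha> r s"
      "ereal (v powr z * (1 / \<kappa> * (1/2) powr (d * (\<kappa> + x)))) \<le> riesz_V TYPE('n) \<alpha> s r"
      using V by (simp_all only:)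
    moreover have "c \<le> ereal (v powr z * (1 / \<kappa> * (1/2) powr (d * (\<kappa> + x))))"
      using constant_le_balls[OF x \<kappa> xy sum d(1) z] False by (intro c_le) (simp only: Q_def not_le)
    ultimately show "c \<le> riesz_V TYPE('n) \<alpha> r s \<and> c \<le> riesz_V TYPE('n) \<alpha> s r"
      by (meson order_trans)
  qed
qed

theorem theorem2:
  fixes \<alpha> r s :: real
  assumes "CARD('n::finite) \<ge> 2"
    and "0 < \<alpha>" and "\<alpha> < real CARD('n)"
    and "r > 1" and "s > 1"
    and "1 / r + 1 / s = 1 + \<alpha> / real CARD('n)"
  shows "riesz_V TYPE('n) \<alpha> r s
    \<ge> ereal (riesz_R \<alpha> CARD('n) / ((r - 1) * (s - 1)) powr (1 - \<alpha> / real CARD('n)))"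
proof (cases "r \<le> s")
  case True
  with assms show ?thesis by (intro riesz_V_ge_of_le(1))
next
  case False
  with assms show ?thesis
    using riesz_V_ge_of_le(2)[of \<alpha> s r, where 'n = 'n] by (simp add: add.commute mult.commute)
qed

end
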